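(* Let $n\ge 1$ be an integer. There exist constants $c_1,c_2>0$ depending only on $n$ such that for every integer $H\ge1$ and all non-negative integers $r,s$ with $n=r+2s$, $$c_1H^{n+1}\le D_n^*(r,s;H)\le c_2H^{n+1}.$$
   Context: The height of a polynomial $f(X)=a_0X^n+a_1X^{n-1}+\cdots+a_n$ is $H(f)=\max_{0\le j\le n}|a_j|$. For positive integers $n,H$ and non-negative integers $r,s$ with $n=r+2s$, $D_n^*(r,s;H)$ denotes the number of polynomials $f(X)=a_0X^n+a_1X^{n-1}+\cdots+a_n\in\mathbb{Z}[X]$ with $a_0\ne0$, $H(f)\le H$, having exactly $r$ real roots and exactly $2s$ non-real (complex) roots, where roots are counted with multiplicity. *)

theory Defs
  imports "HOL-Computational_Algebra.Computational_Algebra"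
begin

(* Applied below to f of degree n, where the coefficients
   coeff f n, ..., coeff f 0 are a_0, ..., a_n. *)
definition poly_height :: "int poly \<Rightarrow> int" where
  "poly_height f = Max ((\<lambda>j. \<bar>coeff f j\<bar>) ` {0..degree f})"

definition complex_roots :: "int poly \<Rightarrow> complex multiset" where
  "complex_roots f = proots (map_poly of_int f)"

definition num_real_roots :: "int poly \<Rightarrow> nat" where
  "num_real_roots f = size (filter_mset (\<lambda>z. z \<in> \<real>) (complex_roots f))"

definition num_nonreal_roots :: "int poly \<Rightarrow> nat" where
  "num_nonreal_roots f = size (filter_mset (\<lambda>z. z \<notin> \<real>) (complex_roots f))"

(* The set is finite, since degree and coefficients are bounded, so card is the actual count.
   The argument n is kept explicit although only n = r + 2 * s is of interest. *)
definition D_star :: "nat \<Rightarrow> nat \<Rightarrow> nat \<Rightarrow> nat \<Rightarrow> nat" where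
  "D_star n r s H = card {f :: int poly.
     degree f = n \<and> coeff f n \<noteq> 0 \<and> poly_height f \<le> int H \<and>
     num_real_roots f = r \<and> num_nonreal_roots f = 2 * s}"

end

(* The upper bound counts coefficient vectors. For the lower bound, take the real polynomial
   g = (prod_{i<r} (X - e i)) (1 + X^2 + ... + X^(2s)) with e > 0 small. Near g a polynomial changes
   sign r times, so it has at least r real roots; its r-th derivative is close to that of
   X^r (1 + X^2 + ... + X^(2s)), hence positive everywhere, so by Rolle's theorem it has at most
   r real roots with multiplicity. Thus a box around g consists of polynomials with exactly r real
   roots, and the integer points of its dilate by a multiple of H are counted by D_n^*. When the
   dilated box is too small to contain integer points, X^r (1 + X^2 + ... + X^(2s)) itself is
   enough. *)
theory Submission
  imports Defs
begin

section \<open>Real roots of real polynomials, counted with multiplicity\<close>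

definition real_root_count :: "real poly \<Rightarrow> nat" where
  "real_root_count p = size (filter_mset (\<lambda>z. z \<in> \<real>) (proots (map_poly complex_of_real p)))"

lemma poly_map_poly_of_real:
  "poly (map_poly complex_of_real p) (complex_of_real x) = complex_of_real (poly p x)"
  by (simp add: poly_altdef degree_map_poly coeff_map_poly)

lemma map_poly_of_real_eq_0_iff [simp]: "map_poly complex_of_real p = 0 \<longleftrightarrow> p = 0"
  by (simp add: map_poly_eq_0_iff)

lemma pderiv_map_poly_of_real:
  "pderiv (map_poly complex_of_real p) = map_poly complex_of_real (pderiv p)"
  by (intro poly_eqI) (simp add: coeff_pderiv coeff_map_poly)

text \<open>Orders are taken in the complexified polynomial because \<open>real_root_count\<close>,
  like \<open>num_real_roots\<close>, filters the complex root multiset. \<open>A\<close> may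
  contain points that are not roots, which contribute 0; it is later the union of the roots of a
  polynomial and the Rolle points between them.\<close>

lemma sum_order_le_real_root_count:
  assumes "finite A" and "p \<noteq> 0"
  shows "(\<Sum>x\<in>A. order (complex_of_real x) (map_poly complex_of_real p)) \<le> real_root_count p"
proof -
  define P where "P = map_poly complex_of_real p"
  define M where "M = filter_mset (\<lambda>z. z \<in> \<real>) (proots P)"
  have "P \<noteq> 0" using assms by (simp add: P_def)
  then have "(\<Sum>x\<in>A. order (complex_of_real x) P) = (\<Sum>x\<in>A. count M (complex_of_real x))"
    by (intro sum.cong) (auto simp: M_def)
  also have "\<dots> = (\<Sum>z\<in>complex_of_real ` A. count M z)"
    by (simp add: sum.reindex inj_on_def)
  also have "\<dots> \<le> (\<Sum>z\<in>complex_of_real ` A \<union> set_mset M. count M z)"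
    using assms by (intro sum_mono2) auto
  also have "\<dots> = (\<Sum>z\<in>set_mset M. count M z)"
    using assms by (intro sum.mono_neutral_right) (auto simp: not_in_iff)
  also have "\<dots> = size M" by (simp add: size_multiset_overloaded_eq)
  finally show ?thesis by (simp add: real_root_count_def M_def P_def)
qed

lemma real_root_count_eq_sum_order:
  assumes "p \<noteq> 0"
  shows "real_root_count p =
    (\<Sum>x | poly p x = 0. order (complex_of_real x) (map_poly complex_of_real p))"
proof -
  define P where "P = map_poly complex_of_real p"
  define M where "M = filter_mset (\<lambda>z. z \<in> \<real>) (proots P)"
  have P: "P \<noteq> 0" using assms by (simp add: P_def)
  have "set_mset M = complex_of_real ` {x. poly p x = 0}"
    using P by (auto simp: M_def P_def Reals_def poly_map_poly_of_real)
  then have "size M = (\<Sum>z\<in>complex_of_real ` {x. poly p x = 0}. count M z)"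
    by (simp add: size_multiset_overloaded_eq)
  also have "\<dots> = (\<Sum>x | poly p x = 0. count M (complex_of_real x))"
    by (simp add: sum.reindex inj_on_def)
  also have "\<dots> = (\<Sum>x | poly p x = 0. order (complex_of_real x) P)"
    using P by (intro sum.cong) (auto simp: M_def)
  finally show ?thesis by (simp add: real_root_count_def M_def P_def)
qed

lemma card_roots_le_real_root_count:
  assumes "finite A" and "p \<noteq> 0" and "\<And>x. x \<in> A \<Longrightarrow> poly p x = 0"
  shows "card A \<le> real_root_count p"
proof -
  have "card A = (\<Sum>x\<in>A. 1)" by simp
  also have "\<dots> \<le> (\<Sum>x\<in>A. order (complex_of_real x) (map_poly complex_of_real p))"
    using assms(2,3) by (intro sum_mono) (simp add: Suc_le_eq order_gt_0_iff poly_map_poly_of_real)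
  finally show ?thesis using sum_order_le_real_root_count[OF assms(1,2)] by simp
qed

section \<open>Rolle's theorem and the root count of derivatives\<close>

text \<open>The clause \<open>\<exists>a\<in>A. x < a\<close> keeps the new root of the induction step apart from the old ones.\<close>
lemma Rolle_card:
  fixes p :: "real poly"
  assumes "finite A" and "\<And>x. x \<in> A \<Longrightarrow> poly p x = 0"
  shows "\<exists>B. finite B \<and> card A \<le> card B + 1 \<and> B \<inter> A = {} \<and>
    (\<forall>x\<in>B. poly (pderiv p) x = 0 \<and> (\<exists>a\<in>A. x < a))"
  using assms
proof (induction A rule: finite_linorder_max_induct)
  case empty
  then show ?case by (intro exI[of _ "{}"]) auto
next
  case (insert b A)
  then obtain B where B: "finite B" "card A \<le> card B + 1" "B \<inter> A = {}"
    "\<forall>x\<in>B. poly (pderiv p) x = 0 \<and> (\<exists>a\<in>A. x < a)" by auto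
  show ?case
  proof (cases "A = {}")
    case True
    then show ?thesis by (intro exI[of _ "{}"]) auto
  next
    case False
    define m where "m = Max A"
    have m: "m \<in> A" "\<And>a. a \<in> A \<Longrightarrow> a \<le> m"
      using False insert.hyps by (auto simp: m_def)
    have "m < b" using m insert.hyps by auto
    from poly_MVT[OF this, of p] obtain y where y: "m < y" "y < b"
      "poly p b - poly p m = (b - m) * poly (pderiv p) y" by auto
    have "poly (pderiv p) y = 0" using y insert.prems m \<open>m < b\<close> by auto
    moreover have "y \<notin> A" "y \<notin> B" "b \<notin> B"
      using y m B(4) insert.hyps by force+
    ultimately show ?thesis
      using B y insert.hyps by (intro exI[of _ "insert y B"]) force
  qed
qed

text \<open>At a root of \<open>p\<close> differentiation lowers the order by exactly one, so the
  total loss is the number of distinct real roots. All but at most one of these are recovered from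
  the Rolle points, which are roots of \<open>pderiv p\<close> outside the root set of
  \<open>p\<close>.\<close>

lemma real_root_count_le_pderiv: "real_root_count p \<le> real_root_count (pderiv p) + 1"
proof (cases "pderiv p = 0")
  \<comment> \<open>A constant polynomial, zero included, has empty \<open>proots\<close>, so its
    count is 0.\<close>
  case True
  then obtain c where "p = [:c:]" by (metis pderiv_eq_0_iff degree_eq_zeroE)
  then show ?thesis by (simp add: real_root_count_def map_poly_pCons)
next
  case False
  then have "p \<noteq> 0" by auto
  define A where "A = {x. poly p x = 0}"
  have finA: "finite A" using \<open>p \<noteq> 0\<close> by (simp add: A_def poly_roots_finite)
  define P where "P = map_poly complex_of_real p"
  define Q where "Q = map_poly complex_of_real (pderiv p)"
  have PQ: "pderiv P = Q" by (simp add: P_def Q_def pderiv_map_poly_of_real)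
  have "P \<noteq> 0" "Q \<noteq> 0" using False \<open>p \<noteq> 0\<close> by (auto simp: P_def Q_def)
  obtain B where B: "finite B" "card A \<le> card B + 1" "B \<inter> A = {}"
    "\<forall>x\<in>B. poly (pderiv p) x = 0"
    using Rolle_card[OF finA, of p] unfolding A_def mem_Collect_eq by blast
  have "real_root_count p = (\<Sum>x\<in>A. order (complex_of_real x) P)"
    using real_root_count_eq_sum_order[OF \<open>p \<noteq> 0\<close>] by (simp add: A_def P_def)
  also have "\<dots> = (\<Sum>x\<in>A. order (complex_of_real x) Q + 1)"
  proof (intro sum.cong refl)
    fix x assume "x \<in> A"
    then have "poly P (complex_of_real x) = 0"
      by (simp add: A_def P_def poly_map_poly_of_real)
    then have "order (complex_of_real x) P = Suc (order (complex_of_real x) (pderiv P))"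
      using \<open>P \<noteq> 0\<close> \<open>Q \<noteq> 0\<close> PQ by (intro order_pderiv) (auto simp: order_eq_0_iff)
    then show "order (complex_of_real x) P = order (complex_of_real x) Q + 1"
      by (simp add: PQ)
  qed
  also have "\<dots> \<le> (\<Sum>x\<in>A. order (complex_of_real x) Q) + (card B + 1)"
    unfolding sum.distrib using B(2) by simp
  also have "card B \<le> (\<Sum>x\<in>B. order (complex_of_real x) Q)"
  proof -
    have "(\<Sum>x\<in>B. 1) \<le> (\<Sum>x\<in>B. order (complex_of_real x) Q)"
      using B(4) \<open>Q \<noteq> 0\<close>
      by (intro sum_mono) (simp add: Suc_le_eq order_gt_0_iff Q_def poly_map_poly_of_real)
    then show ?thesis by simp
  qed
  also have "(\<Sum>x\<in>A. order (complex_of_real x) Q) + ((\<Sum>x\<in>B. order (complex_of_real x) Q) + 1)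
      = (\<Sum>x\<in>A \<union> B. order (complex_of_real x) Q) + 1"
    using finA B by (subst sum.union_disjoint) auto
  also have "\<dots> \<le> real_root_count (pderiv p) + 1"
    using sum_order_le_real_root_count[of "A \<union> B" "pderiv p"] finA B(1) False
    by (simp add: Q_def)
  finally show ?thesis by simp
qed

lemma real_root_count_le_higher_pderiv:
  "real_root_count p \<le> real_root_count ((pderiv ^^ k) p) + k"
proof (induction k)
  case (Suc k)
  then show ?case using real_root_count_le_pderiv[of "(pderiv ^^ k) p"] by simp
qed simp

lemma real_root_count_eq_0:
  assumes "\<And>x. poly p x \<noteq> 0"
  shows "real_root_count p = 0"
proof -
  have "p \<noteq> 0" using assms[of 0] by auto
  then show ?thesis using real_root_count_eq_sum_order[of p] assms by simp
qed

lemma real_root_count_monom_mult: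
  assumes "p \<noteq> 0"
  shows "real_root_count (monom 1 r * p) = r + real_root_count p"
proof -
  have "map_poly complex_of_real (monom 1 r * p) = [:0, 1:] ^ r * map_poly complex_of_real p"
    by (intro poly_eqI) (simp add: coeff_map_poly coeff_monom_mult flip: monom_altdef[of 1, simplified])
  moreover have "size {#z \<in># replicate_mset r (0 :: complex). z \<in> \<real>#} = r"
    by (induction r) simp_all
  ultimately show ?thesis
    using assms by (simp add: real_root_count_def proots_mult proots_power)
qed

section \<open>Positivity of polynomials dominated by their even coefficients\<close>

text \<open>Each odd term is absorbed by its even neighbours via \<open>2 * \<bar>x\<bar> \<le> 1 + x\<^sup>2\<close>.\<close>
lemma even_dominated_sum_lower_bound:
  fixes b :: "nat \<Rightarrow> real"
  assumes "c > 0" and "\<And>j. j \<le> 2 * s \<Longrightarrow> even j \<Longrightarrow> c \<le> b j"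
    and "\<And>j. j \<le> 2 * s \<Longrightarrow> odd j \<Longrightarrow> \<bar>b j\<bar> \<le> c / 2"
  shows "c / 4 * (1 + x ^ (2 * s)) \<le> (\<Sum>j\<le>2 * s. b j * x ^ j)"
  using assms(2,3)
proof (induction s)
  case 0
  then show ?case using \<open>c > 0\<close> by (auto simp: field_simps intro: order.trans)
next
  case (Suc s)
  define t where "t = x ^ (2 * s)"
  have t: "t \<ge> 0" by (simp add: t_def power_mult)
  have IH: "c / 4 * (1 + t) \<le> (\<Sum>j\<le>2 * s. b j * x ^ j)"
    unfolding t_def by (intro Suc.IH Suc.prems; simp)
  have 1: "c \<le> b (2 * s + 2)" and 2: "\<bar>b (2 * s + 1)\<bar> \<le> c / 2"
    using Suc.prems(1)[of "2*s+2"] Suc.prems(2)[of "2*s+1"] by auto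
  have "\<bar>b (2 * s + 1) * x\<bar> \<le> c / 2 * ((1 + x\<^sup>2) / 2)"
    unfolding abs_mult
  proof (rule mult_mono)
    have "0 \<le> (\<bar>x\<bar> - 1)\<^sup>2" by simp
    then show "\<bar>x\<bar> \<le> (1 + x\<^sup>2) / 2" by (simp add: power2_diff)
  qed (use 2 \<open>c > 0\<close> in auto)
  moreover have "c * x\<^sup>2 \<le> b (2 * s + 2) * x\<^sup>2" using 1 by (intro mult_right_mono) auto
  ultimately have "c * x\<^sup>2 - c / 2 * ((1 + x\<^sup>2) / 2) \<le> b (2 * s + 1) * x + b (2 * s + 2) * x\<^sup>2"
    by linarith
  from mult_right_mono[OF this t]
  have "(c * x\<^sup>2 - c / 2 * ((1 + x\<^sup>2) / 2)) * t
      \<le> b (2 * s + 1) * x ^ (2 * s + 1) + b (2 * s + 2) * x ^ (2 * s + 2)"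
    by (simp add: t_def power_add algebra_simps power2_eq_square)
  moreover have "(\<Sum>j\<le>2 * Suc s. b j * x ^ j)
     = (\<Sum>j\<le>2 * s. b j * x ^ j) + (b (2 * s + 1) * x ^ (2 * s + 1) + b (2 * s + 2) * x ^ (2 * s + 2))"
    by simp
  \<comment> \<open>The odd term costs at most \<open>c / 4 * t\<close> and
    \<open>c / 4 * x^2 * t\<close>. The first is paid by the reserve \<open>c / 4 * t\<close> that
    the induction hypothesis carries; after the second, the new even term retains
    \<open>3 / 4 * c * x^2 * t\<close>, more than the next reserve.\<close>
  moreover have "c / 4 * (1 + x ^ (2 * Suc s))
      \<le> c / 4 * (1 + t) + (c * x\<^sup>2 - c / 2 * ((1 + x\<^sup>2) / 2)) * t"
  proof -
    have "x ^ (2 * Suc s) = x\<^sup>2 * t" by (simp add: t_def power_add power2_eq_square)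
    moreover have "0 \<le> c * (x\<^sup>2 * t)" using \<open>c > 0\<close> t by simp
    ultimately show ?thesis by (simp add: field_simps)
  qed
  ultimately show ?case using IH by linarith
qed

section \<open>The model polynomial and its sign changes\<close>

text \<open>All even coefficients are 1, not only the outer two: after a perturbation and
  \<open>r\<close> differentiations, the odd coefficients may be nonzero and must be dominated by
  even neighbours on both sides.\<close>

definition even_geom :: "nat \<Rightarrow> real poly" where
  "even_geom s = (\<Sum>i\<le>s. monom 1 (2 * i))"

lemma poly_even_geom_pos: "poly (even_geom s) x > 0"
proof -
  have "poly (even_geom s) x = (\<Sum>i\<le>s. (x\<^sup>2) ^ i)"
    by (simp add: even_geom_def poly_sum poly_monom power_mult)
  also have "\<dots> > 0" by (rule sum_pos2[of _ 0]) auto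
  finally show ?thesis .
qed

lemma coeff_even_geom: "coeff (even_geom s) j = (if even j \<and> j \<le> 2 * s then 1 else 0)"
proof -
  have "coeff (even_geom s) j = (\<Sum>i\<le>s. if 2 * i = j then 1 else 0)"
    by (simp add: even_geom_def coeff_sum)
  also have "\<dots> = (\<Sum>i\<in>{i. i \<le> s \<and> 2 * i = j}. 1)"
    by (intro sum.mono_neutral_cong_right) auto
  also have "{i. i \<le> s \<and> 2 * i = j} = (if even j \<and> j \<le> 2 * s then {j div 2} else {})"
    by auto
  finally show ?thesis by auto
qed

definition clustered :: "nat \<Rightarrow> real \<Rightarrow> real poly" where
  "clustered r e = (\<Prod>i<r. [:- (e * real i), 1:])"

text \<open>A further factor of \<open>clustered\<close> acts on coefficients as a shift minus a
  multiple of \<open>e\<close>, and the latter vanishes in the limit. The shift is why the induction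
  needs arbitrary \<open>j\<close>.\<close>

lemma tendsto_coeff_clustered_mult:
  "((\<lambda>e. coeff (clustered r e * q) j) \<longlongrightarrow> coeff (monom 1 r * q) j) (at_right 0)"
proof (induction r arbitrary: j)
  case 0
  then show ?case by (simp add: clustered_def monom_0 flip: one_pCons)
next
  case (Suc r)
  have *: "clustered (Suc r) e * q
      = pCons 0 (clustered r e * q) - smult (e * real r) (clustered r e * q)" for e
    by (simp add: clustered_def algebra_simps)
  have **: "monom 1 (Suc r) * q = pCons 0 (monom 1 r * q)"
    by (simp add: monom_Suc)
  have "((\<lambda>e. coeff (pCons 0 (clustered r e * q)) j) \<longlongrightarrow> coeff (pCons 0 (monom 1 r * q)) j)
      (at_right 0)"
    using Suc.IH by (cases j) auto
  moreover have "((\<lambda>e. e * real r * coeff (clustered r e * q) j) \<longlongrightarrow>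
      0 * real r * coeff (monom 1 r * q) j) (at_right 0)"
    by (intro tendsto_intros Suc.IH)
  ultimately have "((\<lambda>e. coeff (pCons 0 (clustered r e * q)) j - e * real r * coeff (clustered r e * q) j)
      \<longlongrightarrow> coeff (pCons 0 (monom 1 r * q)) j - 0 * real r * coeff (monom 1 r * q) j) (at_right 0)"
    by (rule tendsto_diff)
  then show ?case
    unfolding * ** coeff_diff coeff_smult by simp
qed

lemma poly_clustered: "poly (clustered r e) x = (\<Prod>j<r. x - e * real j)"
  by (simp add: clustered_def poly_prod)

text \<open>The two points lie \<open>e / 2\<close> to either side of the root \<open>e * i\<close>.
  Multiplying the values factor by factor gives \<open>e^2 * ((i - j)^2 - 1 / 4)\<close>, which is
  negative for \<open>j = i\<close> only.\<close>

lemma poly_clustered_sign_change: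
  assumes "e > 0" and "i < r"
  shows "poly (clustered r e) (e * (real i - 1 / 2)) * poly (clustered r e) (e * (real (Suc i) - 1 / 2)) < 0"
proof -
  let ?f = "\<lambda>j. (e * (real i - 1 / 2) - e * real j) * (e * (real (Suc i) - 1 / 2) - e * real j)"
  have f: "?f j = e\<^sup>2 * ((real i - real j)\<^sup>2 - 1 / 4)" for j
    by (simp add: power2_eq_square field_simps)
  have "prod ?f ({..<r} - {i}) > 0"
  proof (rule prod_pos)
    fix j assume "j \<in> {..<r} - {i}"
    then have "1 \<le> \<bar>real i - real j\<bar>" by auto
    then have "1 \<le> (real i - real j)\<^sup>2" by (simp add: abs_le_square_iff[of 1, simplified])
    then show "0 < ?f j" unfolding f using \<open>e > 0\<close> by (intro mult_pos_pos) auto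
  qed
  moreover have "?f i < 0" unfolding f using \<open>e > 0\<close> by (intro mult_pos_neg) auto
  moreover have "prod ?f {..<r} = ?f i * prod ?f ({..<r} - {i})"
    using \<open>i < r\<close> by (subst prod.remove[of _ i]) auto
  ultimately have "prod ?f {..<r} < 0" by (simp only: mult_neg_pos)
  then show ?thesis by (simp only: poly_clustered prod.distrib)
qed

text \<open>In units of \<open>e\<close> the roots are integers and the point is half an odd
  integer.\<close>

lemma poly_clustered_nonzero:
  assumes "e > 0"
  shows "poly (clustered r e) (e * (real i - 1 / 2)) \<noteq> 0"
proof -
  have "real i - 1 / 2 \<noteq> real j" for j
  proof
    assume "real i - 1 / 2 = real j"
    then have "real (2 * i) = real (2 * j + 1)" by simp
    then have "2 * i = 2 * j + 1" by (simp only: of_nat_eq_iff)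
    then show False by presburger
  qed
  then show ?thesis using assms by (auto simp: poly_clustered)
qed

section \<open>Stability of the root count under small changes of coefficients\<close>

lemma abs_poly_diff_le:
  fixes p g :: "real poly"
  assumes "degree p \<le> n" "degree g \<le> n" "\<And>j. j \<le> n \<Longrightarrow> \<bar>coeff p j - coeff g j\<bar> \<le> d"
  shows "\<bar>poly p x - poly g x\<bar> \<le> d * (\<Sum>j\<le>n. \<bar>x\<bar> ^ j)"
proof -
  have "degree (p - g) \<le> n" using assms(1,2) by (rule degree_diff_le)
  then have "poly (p - g) x = (\<Sum>j\<le>n. coeff (p - g) j * x ^ j)"
    unfolding poly_altdef
    by (intro sum.mono_neutral_left) (auto intro: le_degree)
  then have "\<bar>poly p x - poly g x\<bar> = \<bar>\<Sum>j\<le>n. (coeff p j - coeff g j) * x ^ j\<bar>" by simp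
  also have "\<dots> \<le> (\<Sum>j\<le>n. \<bar>(coeff p j - coeff g j) * x ^ j\<bar>)" by (rule sum_abs)
  also have "\<dots> \<le> (\<Sum>j\<le>n. d * \<bar>x\<bar> ^ j)"
    using assms(3) by (intro sum_mono) (auto simp: abs_mult power_abs intro!: mult_right_mono)
  finally show ?thesis by (simp add: sum_distrib_left)
qed

lemma real_root_count_ge_sign_changes:
  fixes x :: "nat \<Rightarrow> real"
  assumes "strict_mono x" and "\<And>i. i < r \<Longrightarrow> poly p (x i) * poly p (x (Suc i)) < 0" and "p \<noteq> 0"
  shows "r \<le> real_root_count p"
proof -
  have "\<exists>y. x i < y \<and> y < x (Suc i) \<and> poly p y = 0" if "i < r" for i
    using poly_IVT[of "x i" "x (Suc i)" p] assms that by (auto simp: strict_mono_Suc_iff)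
  then obtain y where y: "\<And>i. i < r \<Longrightarrow> x i < y i \<and> y i < x (Suc i) \<and> poly p (y i) = 0"
    by metis
  have "y i < y j" if "i < j" "j < r" for i j
  proof -
    have "x (Suc i) \<le> x j" using assms(1) that by (simp add: strict_mono_less_eq)
    then show ?thesis using y[of i] y[of j] that by auto
  qed
  then have "inj_on y {..<r}"
    by (intro linorder_inj_onI) (auto simp: less_imp_neq)
  then have "card (y ` {..<r}) = r" by (simp add: card_image)
  then show ?thesis
    using card_roots_le_real_root_count[of "y ` {..<r}" p] y \<open>p \<noteq> 0\<close> by auto
qed

text \<open>The choices are made in the order \<open>h\<close>, \<open>e\<close>, \<open>d\<close>.
  The radius \<open>h\<close> around the limit \<open>monom 1 r * even_geom s\<close> keeps the
  \<open>r\<close>-th derivative positive, which bounds the root count above. Then \<open>e\<close>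
  puts the model within \<open>h / 2\<close> of that limit, and \<open>d\<close> preserves the signs
  of this model at sample points, which bounds the count below.\<close>

lemma exists_robust_poly:
  "\<exists>g d. d > 0 \<and> (\<forall>p. degree p \<le> r + 2 * s \<longrightarrow> (\<forall>j\<le>r + 2 * s. \<bar>coeff p j - g j\<bar> \<le> d) \<longrightarrow>
     degree p = r + 2 * s \<and> real_root_count p = r)"
proof -
  define n where "n = r + 2 * s"
  \<comment> \<open>The \<open>r\<close>-th derivative turns coefficient \<open>r + j\<close> into
    coefficient \<open>j\<close> with the factor (j+1)(j+2)...(j+r).\<close>
  define w where "w = (\<lambda>j. pochhammer (real (Suc j)) r)"
  have w1: "1 \<le> w j" for j
  proof -
    have "pochhammer (Suc j) r > 0" by (rule pochhammer_pos) simp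
    then have "1 \<le> real (pochhammer (Suc j) r)" by linarith
    then show ?thesis by (simp only: w_def pochhammer_of_nat)
  qed
  define W where "W = (\<Sum>j\<le>2 * s. w j)"
  have wW: "w j \<le> W" if "j \<le> 2 * s" for j
    unfolding W_def using that w1 by (intro member_le_sum) (auto intro: order.trans[OF zero_le_one])
  have W1: "1 \<le> W" using wW[of 0] w1[of 0] by simp
  \<comment> \<open>This makes odd coefficients of the \<open>r\<close>-th derivative at most
    \<open>W * h = 1 / 4\<close> in absolute value, while even ones are at least
    \<open>1 - h\<close>, hence at least \<open>1 / 2\<close>: the domination lemma applies with
    \<open>c = 1 / 2\<close>.\<close>
  define h where "h = 1 / (4 * W)"
  have h: "0 < h" "h \<le> 1 / 4" "W * h = 1 / 4" using W1 by (auto simp: h_def field_simps)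
  define G where "G = (\<lambda>e. clustered r e * even_geom s)"
  have "eventually (\<lambda>e. \<forall>j\<in>{..n}. \<bar>coeff (G e) j - coeff (monom 1 r * even_geom s) j\<bar> < h / 2) (at_right 0)"
    using tendstoD[OF tendsto_coeff_clustered_mult[of r "even_geom s"], of "h/2"] h
    by (intro eventually_ball_finite) (auto simp: G_def dist_real_def)
  moreover have "eventually (\<lambda>e::real. e > 0) (at_right 0)" by (rule eventually_at_right_less)
  ultimately obtain e where e: "e > 0"
    "\<And>j. j \<le> n \<Longrightarrow> \<bar>coeff (G e) j - coeff (monom 1 r * even_geom s) j\<bar> < h / 2"
    using eventually_happens'[OF trivial_limit_at_right_real eventually_conj] by blast
  \<comment> \<open>The points with index 0 to \<open>r\<close> separate the \<open>r\<close> roots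
    of \<open>clustered r e\<close>.\<close>
  define x where "x = (\<lambda>i. e * (real i - 1 / 2))"
  have x_mono: "strict_mono x" using e(1) by (auto simp: x_def strict_mono_Suc_iff)
  have G0: "poly (G e) (x i) \<noteq> 0" for i
    using poly_clustered_nonzero[OF e(1)] poly_even_geom_pos[of s "x i"] by (simp add: G_def x_def)
  have Gsc: "poly (G e) (x i) * poly (G e) (x (Suc i)) < 0" if "i < r" for i
  proof -
    have "(poly (clustered r e) (x i) * poly (clustered r e) (x (Suc i))) *
        (poly (even_geom s) (x i) * poly (even_geom s) (x (Suc i))) < 0"
      using poly_clustered_sign_change[OF e(1) that] poly_even_geom_pos
      unfolding x_def by (intro mult_neg_pos[OF _ mult_pos_pos])
    then show ?thesis by (simp add: G_def mult_ac)
  qed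
  have degG: "degree (G e) \<le> n"
  proof -
    have "degree (clustered r e) \<le> (\<Sum>i<r. degree [:- (e * real i), 1:])"
      unfolding clustered_def by (rule degree_prod_sum_le[unfolded o_def]) auto
    moreover have "degree (even_geom s) \<le> 2 * s"
      by (intro degree_le) (auto simp: coeff_even_geom)
    ultimately show ?thesis
      using degree_mult_le[of "clustered r e" "even_geom s"] by (simp add: G_def n_def)
  qed
  \<comment> \<open>A coefficient change of at most \<open>d\<close> moves the value at
    \<open>x i\<close> by at most \<open>d * C i\<close>, so the sign survives once this is below
    the absolute value of the model there. Only \<open>r + 1\<close> points matter, so one
    \<open>d\<close> suffices.\<close>
  define C where "C = (\<lambda>i. \<Sum>j\<le>n. \<bar>x i\<bar> ^ j)"
  have "eventually (\<lambda>d. \<forall>i\<in>{..r}. d * C i < \<bar>poly (G e) (x i)\<bar>) (at_right 0)"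
  proof (intro eventually_ball_finite ballI)
    fix i
    have "((\<lambda>d. d * C i) \<longlongrightarrow> 0 * C i) (at_right 0)" by (intro tendsto_intros)
    then show "eventually (\<lambda>d. d * C i < \<bar>poly (G e) (x i)\<bar>) (at_right 0)"
      by (rule order_tendstoD) (use G0 in auto)
  qed auto
  moreover have "eventually (\<lambda>d. d \<in> {0<..<h / 2}) (at_right 0)"
    by (rule eventually_at_right_real) (use h in auto)
  ultimately have "eventually (\<lambda>d. (\<forall>i\<in>{..r}. d * C i < \<bar>poly (G e) (x i)\<bar>) \<and> d \<in> {0<..<h / 2}) (at_right 0)"
    by (rule eventually_conj)
  then obtain d where d: "0 < d" "d < h / 2" "\<And>i. i \<le> r \<Longrightarrow> d * C i < \<bar>poly (G e) (x i)\<bar>"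
    using eventually_happens'[OF trivial_limit_at_right_real] by force
  show ?thesis
  proof (intro exI[of _ "coeff (G e)"] exI[of _ d] conjI allI impI d(1))
    fix p :: "real poly"
    assume deg: "degree p \<le> r + 2 * s" and close: "\<forall>j\<le>r + 2 * s. \<bar>coeff p j - coeff (G e) j\<bar> \<le> d"
    \<comment> \<open>The distance to the limit splits into less than \<open>h / 2\<close> from the
      limit to \<open>G e\<close> and at most \<open>d < h / 2\<close> from there to
      \<open>p\<close>.\<close>
    have cp: "\<bar>coeff p (r + j) - (if even j then 1 else 0)\<bar> \<le> h" if "j \<le> 2 * s" for j
    proof -
      have "coeff (monom 1 r * even_geom s) (r + j) = (if even j then 1 else 0)"
        using that by (simp add: coeff_monom_mult coeff_even_geom)
      then show ?thesis
        using e(2)[of "r + j"] close[rule_format, of "r + j"] d(2) that unfolding n_def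
        by (smt (verit) add_left_mono field_sum_of_halves)
    qed
    have "coeff p (r + 2 * s) \<noteq> 0" using cp[of "2 * s"] h by auto
    then show degp: "degree p = r + 2 * s" using deg le_degree[of p "r + 2 * s"] by simp
    have "p \<noteq> 0" using \<open>coeff p (r + 2 * s) \<noteq> 0\<close> by auto
    have same: "0 < poly p (x i) * poly (G e) (x i)" if "i \<le> r" for i
    proof -
      have "\<bar>poly p (x i) - poly (G e) (x i)\<bar> \<le> d * C i"
        unfolding C_def using deg degG close by (intro abs_poly_diff_le) (auto simp: n_def)
      then show ?thesis using d(3)[OF that]
        by (smt (verit) zero_less_mult_iff)
    qed
    have lower: "r \<le> real_root_count p"
    proof (rule real_root_count_ge_sign_changes[OF x_mono _ \<open>p \<noteq> 0\<close>])
      fix i assume "i < r"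
      then show "poly p (x i) * poly p (x (Suc i)) < 0"
        using same[of i] same[of "Suc i"] Gsc[of i]
        by (smt (verit) zero_less_mult_iff mult_less_0_iff Suc_leI less_imp_le_nat)
    qed
    define D where "D = (pderiv ^^ r) p"
    have cD: "coeff D j = w j * coeff p (r + j)" for j
      by (simp add: D_def w_def coeff_higher_pderiv add.commute)
    have degD: "degree D = 2 * s" by (simp add: D_def degree_higher_pderiv degp)
    have "poly D y > 0" for y
    proof -
      have "0 < 1 / 2 / 4 * (1 + y ^ (2 * s))"
        by (simp add: power_mult add_pos_nonneg)
      also have "\<dots> \<le> (\<Sum>j\<le>2 * s. coeff D j * y ^ j)"
      proof (rule even_dominated_sum_lower_bound)
        fix j assume j: "j \<le> 2 * s" "even j"
        then have "1 / 2 \<le> coeff p (r + j)" using cp[of j] h by auto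
        then have "1 * (1 / 2) \<le> w j * coeff p (r + j)" using w1[of j] by (intro mult_mono) auto
        then show "1 / 2 \<le> coeff D j" by (simp add: cD)
      next
        fix j assume j: "j \<le> 2 * s" "odd j"
        then have "\<bar>coeff p (r + j)\<bar> \<le> h" using cp[of j] by auto
        moreover have "\<bar>w j\<bar> \<le> W" using wW[OF j(1)] w1[of j] by auto
        ultimately have "\<bar>coeff D j\<bar> \<le> W * h"
          using W1 unfolding cD abs_mult by (intro mult_mono) auto
        then show "\<bar>coeff D j\<bar> \<le> 1 / 2 / 2" using h by simp
      qed simp
      also have "\<dots> = poly D y" by (simp add: poly_altdef degD)
      finally show ?thesis .
    qed
    then have "real_root_count D = 0" by (intro real_root_count_eq_0) (auto simp: less_imp_neq[symmetric])
    then show "real_root_count p = r"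
      using lower real_root_count_le_higher_pderiv[of p r] by (simp add: D_def)
  qed
qed

section \<open>From integer polynomials to the set being counted\<close>

lemma real_root_count_smult: "c \<noteq> 0 \<Longrightarrow> real_root_count (smult c p) = real_root_count p"
  by (simp add: real_root_count_def map_poly_smult)

lemma num_real_roots_eq: "num_real_roots f = real_root_count (map_poly of_int f)"
proof -
  have "map_poly complex_of_real (map_poly of_int f) = map_poly of_int f"
    by (intro poly_eqI) (simp add: coeff_map_poly)
  then show ?thesis by (simp add: num_real_roots_def real_root_count_def complex_roots_def)
qed

lemma num_real_plus_nonreal_roots: "num_real_roots f + num_nonreal_roots f = degree f"
proof -
  have "num_real_roots f + num_nonreal_roots f = size (complex_roots f)"
    unfolding num_real_roots_def num_nonreal_roots_def
    by (metis multiset_partition size_union)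
  then show ?thesis by (simp add: complex_roots_def size_proots_complex degree_map_poly)
qed

lemma poly_height_le_iff:
  assumes "degree f \<le> n" and "0 \<le> h"
  shows "poly_height f \<le> h \<longleftrightarrow> (\<forall>j\<le>n. \<bar>coeff f j\<bar> \<le> h)"
proof -
  have "poly_height f \<le> h \<longleftrightarrow> (\<forall>j\<le>degree f. \<bar>coeff f j\<bar> \<le> h)"
    by (auto simp: poly_height_def)
  also have "\<dots> \<longleftrightarrow> (\<forall>j\<le>n. \<bar>coeff f j\<bar> \<le> h)"
    using assms by (metis abs_zero coeff_eq_0 le_trans not_le)
  finally show ?thesis .
qed

definition D_set :: "nat \<Rightarrow> nat \<Rightarrow> nat \<Rightarrow> int poly set" where
  "D_set r s H = {f. degree f = r + 2 * s \<and> (\<forall>j\<le>r + 2 * s. \<bar>coeff f j\<bar> \<le> int H) \<and>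
     num_real_roots f = r}"

text \<open>The nonreal roots make up the rest of the degree, and a polynomial of positive degree
  has a nonzero leading coefficient. For \<open>n = 0\<close> the zero polynomial would lie in
  \<open>D_set\<close> without being counted by \<open>D_star\<close>.\<close>

lemma D_star_eq_card_D_set:
  assumes "n = r + 2 * s" and "n \<ge> 1"
  shows "D_star n r s H = card (D_set r s H)"
proof -
  have "(degree f = n \<and> coeff f n \<noteq> 0 \<and> poly_height f \<le> int H \<and>
     num_real_roots f = r \<and> num_nonreal_roots f = 2 * s) \<longleftrightarrow> f \<in> D_set r s H" for f
  proof -
    have "coeff f n \<noteq> 0" if "degree f = n"
      using that assms(2) by (metis degree_0 leading_coeff_0_iff not_one_le_zero)
    moreover have "num_nonreal_roots f = 2 * s" if "degree f = n" "num_real_roots f = r"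
      using num_real_plus_nonreal_roots[of f] that assms(1) by simp
    moreover have "poly_height f \<le> int H \<longleftrightarrow> (\<forall>j\<le>n. \<bar>coeff f j\<bar> \<le> int H)" if "degree f = n"
      using that by (intro poly_height_le_iff) auto
    ultimately show ?thesis using assms(1) by (auto simp: D_set_def)
  qed
  then show ?thesis by (simp add: D_star_def)
qed

section \<open>Counting integer coefficient vectors in boxes\<close>

definition poly_of_fun :: "nat \<Rightarrow> (nat \<Rightarrow> int) \<Rightarrow> int poly" where
  "poly_of_fun n a = (\<Sum>j\<le>n. monom (a j) j)"

lemma coeff_poly_of_fun: "coeff (poly_of_fun n a) j = (if j \<le> n then a j else 0)"
  by (simp add: poly_of_fun_def coeff_sum)

lemma degree_poly_of_fun: "degree (poly_of_fun n a) \<le> n"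
  by (intro degree_le) (simp add: coeff_poly_of_fun)

lemma inj_on_poly_of_fun: "inj_on (poly_of_fun n) (Pi\<^sub>E {..n} T)"
proof (rule inj_onI)
  fix a b assume ab: "a \<in> Pi\<^sub>E {..n} T" "b \<in> Pi\<^sub>E {..n} T" "poly_of_fun n a = poly_of_fun n b"
  show "a = b"
  proof (rule PiE_ext[OF ab(1,2)])
    fix j assume "j \<in> {..n}"
    then show "a j = b j"
      using arg_cong[OF ab(3), of "\<lambda>f. coeff f j"] by (simp add: coeff_poly_of_fun)
  qed
qed

lemma D_set_subset:
  "D_set r s H \<subseteq> poly_of_fun (r + 2 * s) ` (Pi\<^sub>E {..r + 2 * s} (\<lambda>_. {- int H..int H}))"
proof
  fix f assume f: "f \<in> D_set r s H"
  define a where "a = restrict (coeff f) {..r + 2 * s}"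
  have "f = poly_of_fun (r + 2 * s) a"
    using f by (intro poly_eqI) (auto simp: coeff_poly_of_fun a_def D_set_def coeff_eq_0)
  moreover have "a \<in> Pi\<^sub>E {..r + 2 * s} (\<lambda>_. {- int H..int H})"
    using f by (auto simp: a_def D_set_def abs_le_iff minus_le_iff)
  ultimately show "f \<in> poly_of_fun (r + 2 * s) ` (Pi\<^sub>E {..r + 2 * s} (\<lambda>_. {- int H..int H}))"
    by blast
qed

lemma finite_D_set: "finite (D_set r s H)"
  by (rule finite_subset[OF D_set_subset]) (auto intro!: finite_imageI finite_PiE)

lemma card_D_set_le: "card (D_set r s H) \<le> (2 * H + 1) ^ (r + 2 * s + 1)"
proof -
  have "card (D_set r s H) \<le> card (Pi\<^sub>E {..r + 2 * s} (\<lambda>_. {- int H..int H}))"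
    by (rule order.trans[OF card_mono[OF _ D_set_subset] card_image_le])
      (auto intro!: finite_imageI finite_PiE)
  also have "\<dots> = (2 * H + 1) ^ (r + 2 * s + 1)"
    by (simp add: card_PiE nat_add_distrib nat_mult_distrib)
  finally show ?thesis .
qed

text \<open>The witness X^r (1 + X^2 + ... + X^(2s)) has coefficients 0 and 1 only, so it is
  available already for \<open>H = 1\<close>.\<close>

lemma D_set_nonempty:
  assumes "H \<ge> 1"
  shows "D_set r s H \<noteq> {}"
proof -
  define n where "n = r + 2 * s"
  define f :: "int poly" where "f = poly_of_fun n (\<lambda>j. if r \<le> j \<and> even (j - r) then 1 else 0)"
  have cf: "coeff f j = (if r \<le> j \<and> j \<le> n \<and> even (j - r) then 1 else 0)" for j
    by (simp add: f_def coeff_poly_of_fun del: even_diff_nat)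
  have fE: "map_poly of_int f = monom 1 r * even_geom s"
    by (intro poly_eqI) (auto simp: coeff_map_poly cf coeff_monom_mult coeff_even_geom n_def
        simp del: even_diff_nat)
  have "coeff f n \<noteq> 0" by (simp add: cf n_def)
  then have deg: "degree f = n"
    using degree_poly_of_fun by (simp add: f_def le_degree order_antisym)
  have "even_geom s \<noteq> 0" using poly_even_geom_pos[of s 0] by auto
  then have "real_root_count (monom 1 r * even_geom s) = r"
    using real_root_count_eq_0[of "even_geom s"] poly_even_geom_pos[of s]
    by (simp add: real_root_count_monom_mult less_imp_neq[symmetric])
  then have "num_real_roots f = r" by (simp add: num_real_roots_eq fE)
  then have "f \<in> D_set r s H" using deg assms by (auto simp: D_set_def n_def cf)
  then show ?thesis by blast
qed

text \<open>Rounding both ends inwards leaves more than \<open>2 * u - 1\<close> integers, and this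
  is at least \<open>u\<close> once \<open>u\<close> is at least 1.\<close>

lemma card_integers_in_interval_ge:
  fixes t u :: real
  assumes "u \<ge> 1"
  shows "u \<le> real (card {\<lceil>t - u\<rceil>..\<lfloor>t + u\<rfloor>})"
proof -
  have "u \<le> real_of_int (\<lfloor>t + u\<rfloor> - \<lceil>t - u\<rceil> + 1)" using assms by linarith
  then show ?thesis by simp
qed

lemma card_D_set_ge:
  "\<exists>c>0. \<forall>H\<ge>1. c * real H ^ (r + 2 * s + 1) \<le> real (card (D_set r s H))"
proof -
  define n where "n = r + 2 * s"
  obtain g d where d: "d > 0" and gd: "\<And>p. degree p \<le> n \<Longrightarrow> (\<And>j. j \<le> n \<Longrightarrow> \<bar>coeff p j - g j\<bar> \<le> d) \<Longrightarrow>
     degree p = n \<and> real_root_count p = r"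
    using exists_robust_poly[of r s] unfolding n_def by blast
  \<comment> \<open>\<open>K\<close> bounds every coefficient in the box of radius \<open>d\<close>
    around \<open>g\<close>, so dilating by \<open>t = H / K\<close> keeps the coefficients within
    \<open>H\<close>.\<close>
  define K where "K = d + (\<Sum>j\<le>n. \<bar>g j\<bar>)"
  have K: "K > 0" "\<And>j. j \<le> n \<Longrightarrow> \<bar>g j\<bar> + d \<le> K"
    using d member_le_sum[of _ "{..n}" "\<lambda>j. \<bar>g j\<bar>"] by (auto simp: K_def add_pos_nonneg sum_nonneg)
  show ?thesis
  proof (intro exI[of _ "(d / K) ^ (n + 1)"] conjI allI impI)
    show "0 < (d / K) ^ (n + 1)" using d K by simp
    fix H :: nat assume H: "H \<ge> 1"
    define t where "t = real H / K"
    have t: "t > 0" using H K by (simp add: t_def)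
    define u where "u = t * d"
    have main: "u ^ (n + 1) \<le> real (card (D_set r s H))"
    proof (cases "u \<ge> 1")
      \<comment> \<open>Here the dilated box may miss the integer lattice, but the desired bound is
        at most 1 and a single member of \<open>D_set\<close> is enough, with the same
        constant.\<close>
      case False
      have "u ^ (n + 1) \<le> 1" using False t d by (intro power_le_one) (auto simp: u_def)
      also have "1 \<le> card (D_set r s H)"
        using D_set_nonempty[OF H] finite_D_set by (simp add: Suc_le_eq card_gt_0_iff)
      then have "1 \<le> real (card (D_set r s H))" by simp
      finally show ?thesis .
    next
      case True
      define T where "T = (\<lambda>j. {\<lceil>t * g j - u\<rceil>..\<lfloor>t * g j + u\<rfloor>})"
      have sub: "poly_of_fun n ` Pi\<^sub>E {..n} T \<subseteq> D_set r s H"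
      proof (intro image_subsetI)
        fix a assume a: "a \<in> Pi\<^sub>E {..n} T"
        define f where "f = poly_of_fun n a"
        have cf: "\<bar>real_of_int (coeff f j) - t * g j\<bar> \<le> u" if "j \<le> n" for j
        proof -
          have "a j \<in> T j" using a that by auto
          then show ?thesis using that
            by (auto simp: T_def f_def coeff_poly_of_fun abs_le_iff ceiling_le_iff le_floor_iff algebra_simps)
        qed
        define F where "F = (map_poly of_int f :: real poly)"
        \<comment> \<open>Dividing by \<open>t\<close> leads back to the box around
          \<open>g\<close>; scaling by a nonzero factor changes neither degree nor root
          count.\<close>
        have "degree (smult (1 / t) F) = n \<and> real_root_count (smult (1 / t) F) = r"
        proof (rule gd)
          show "degree (smult (1 / t) F) \<le> n"
            using degree_poly_of_fun t by (simp add: F_def f_def degree_map_poly)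
          fix j assume "j \<le> n"
          from cf[OF this] have "\<bar>real_of_int (coeff f j) - t * g j\<bar> / t \<le> d"
            using t by (simp add: u_def field_simps)
          moreover have "coeff (smult (1 / t) F) j - g j = (real_of_int (coeff f j) - t * g j) / t"
            using t by (simp add: F_def coeff_map_poly diff_divide_distrib)
          ultimately show "\<bar>coeff (smult (1 / t) F) j - g j\<bar> \<le> d" using t by simp
        qed
        then have "degree f = n" "num_real_roots f = r"
          using t by (auto simp: F_def degree_map_poly num_real_roots_eq real_root_count_smult)
        moreover have "\<bar>coeff f j\<bar> \<le> int H" if "j \<le> n" for j
        proof -
          have "\<bar>real_of_int (coeff f j)\<bar> \<le> \<bar>t * g j\<bar> + u" using cf[OF that] by linarith
          also have "\<dots> = t * (\<bar>g j\<bar> + d)" using t by (simp add: u_def abs_mult algebra_simps)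
          also have "\<dots> \<le> t * K" using K(2)[OF that] t by simp
          also have "\<dots> = real H" using K by (simp add: t_def)
          finally show ?thesis by linarith
        qed
        ultimately show "poly_of_fun n a \<in> D_set r s H" by (auto simp: D_set_def f_def n_def)
      qed
      have "u ^ (n + 1) = (\<Prod>j\<le>n. u)" by simp
      also have "\<dots> \<le> (\<Prod>j\<le>n. real (card (T j)))"
        using True unfolding T_def by (intro prod_mono conjI card_integers_in_interval_ge) auto
      also have "\<dots> = real (card (Pi\<^sub>E {..n} T))" by (simp add: card_PiE)
      also have "\<dots> = real (card (poly_of_fun n ` Pi\<^sub>E {..n} T))"
        by (simp add: card_image inj_on_poly_of_fun)
      also have "\<dots> \<le> real (card (D_set r s H))"
        using card_mono[OF finite_D_set sub] by simp
      finally show ?thesis .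
    qed
    have "(d / K) ^ (n + 1) * real H ^ (n + 1) = u ^ (n + 1)"
      by (simp only: u_def t_def power_mult_distrib[symmetric] times_divide_eq_left times_divide_eq_right mult.commute)
    with main show "(d / K) ^ (n + 1) * real H ^ (r + 2 * s + 1) \<le> real (card (D_set r s H))"
      by (simp only: n_def)
  qed
qed

section \<open>Constants depending only on the degree\<close>

theorem theorem1p2:
  fixes n :: nat
  assumes "n \<ge> 1"
  shows "\<exists>c\<^sub>1 c\<^sub>2 :: real. c\<^sub>1 > 0 \<and> c\<^sub>2 > 0 \<and>
    (\<forall>H r s :: nat. H \<ge> 1 \<longrightarrow> n = r + 2 * s \<longrightarrow>
      c\<^sub>1 * real H ^ (n + 1) \<le> real (D_star n r s H) \<and>
      real (D_star n r s H) \<le> c\<^sub>2 * real H ^ (n + 1))"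
proof -
  have "\<forall>z. \<exists>c>0. \<forall>H\<ge>1.
      c * real H ^ (fst z + 2 * snd z + 1) \<le> real (card (D_set (fst z) (snd z) H))"
    using card_D_set_ge by blast
  from choice[OF this] obtain c where c: "\<And>r s. c (r, s) > 0"
    "\<And>r s H. H \<ge> 1 \<Longrightarrow> c (r, s) * real H ^ (r + 2 * s + 1) \<le> real (card (D_set r s H))"
    unfolding split_paired_All fst_conv snd_conv by blast
  \<comment> \<open>Since \<open>r\<close> and \<open>s\<close> are at most \<open>n\<close>, a
    minimum over finitely many pairs removes the dependence on them; it is positive because
    \<open>c\<close> is positive at every pair.\<close>
  define c1 where "c1 = Min (c ` ({..n} \<times> {..n}))"
  have "c1 > 0" unfolding c1_def by (subst Min_gr_iff) (auto simp: c)
  have c1: "c1 \<le> c (r, s)" if "n = r + 2 * s" for r s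
    unfolding c1_def using that by (intro Min_le) force+
  show ?thesis
  \<comment> \<open>The 3 comes from \<open>2 * H + 1\<close> being at most \<open>3 * H\<close>
    when \<open>H\<close> is at least 1.\<close>
  proof (rule exI[of _ c1], rule exI[of _ "3 ^ (n + 1)"], intro conjI allI impI)
    fix H r s :: nat assume H: "H \<ge> 1" and n: "n = r + 2 * s"
    have eq: "D_star n r s H = card (D_set r s H)" by (rule D_star_eq_card_D_set[OF n assms])
    have "c1 * real H ^ (n + 1) \<le> c (r, s) * real H ^ (n + 1)"
      using c1[OF n] by (intro mult_right_mono) auto
    also have "\<dots> \<le> real (D_star n r s H)" using c(2)[OF H, of r s] n eq by simp
    finally show "c1 * real H ^ (n + 1) \<le> real (D_star n r s H)" .
    have "real (D_star n r s H) \<le> real ((2 * H + 1) ^ (n + 1))"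
      unfolding eq using card_D_set_le[of r s H] n by (simp only: of_nat_le_iff)
    also have "\<dots> \<le> real ((3 * H) ^ (n + 1))"
      using H by (simp only: of_nat_le_iff, intro power_mono) auto
    finally show "real (D_star n r s H) \<le> 3 ^ (n + 1) * real H ^ (n + 1)"
      by (simp only: power_mult_distrib of_nat_power of_nat_mult of_nat_numeral)
  qed (use \<open>c1 > 0\<close> in auto)
qed

end
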